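(* Let $n \ge 1$ be an integer, let $x_1, x_2, \dots, x_n$ be real numbers, and let $S$ be a real constant such that $S - x_i > 0$ for every $i = 1, 2, \dots, n$. Put $\bar{x} = \frac{1}{n}\sum_{i=1}^{n} x_i$. Then $$\sum_{i=1}^{n} \frac{1}{S - x_i} \ge \frac{n}{S - \bar{x}},$$ and equality holds if and only if $x_1 = x_2 = \cdots = x_n$. *)

theory Defs
  imports Complex_Main
begin

end

theory Submission
  imports Defs
begin

text \<open>Let \<open>y i = S - x i\<close> and let \<open>m\<close> be the mean of the \<open>y i\<close>. The tangent line to \<open>1 / y\<close> at \<open>m\<close>
  is \<open>2 / m - y / m\<^sup>2\<close>, and its gap to \<open>1 / y\<close> is \<open>(y - m)\<^sup>2 / (y * m\<^sup>2)\<close>. Summation cancels the linear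
  part, so the two sides of the inequality differ by a sum of nonnegative terms, which vanishes
  exactly when every \<open>y i\<close> equals \<open>m\<close>.\<close>

text \<open>An exact identity rather than an estimate, so that the inequality and its equality case
  are both read off the same remainder sum.\<close>

lemma sum_inverse_eq_mean_plus_gap:
  fixes y :: "'a \<Rightarrow> real"
  assumes "\<And>i. i \<in> A \<Longrightarrow> y i \<noteq> 0" and "m \<noteq> 0" and sum: "(\<Sum>i\<in>A. y i) = real (card A) * m"
  shows "(\<Sum>i\<in>A. 1 / y i) = real (card A) / m + (\<Sum>i\<in>A. (y i - m)\<^sup>2 / (y i * m\<^sup>2))"
proof -
  have "1 / y i = 2 / m - y i / m\<^sup>2 + (y i - m)\<^sup>2 / (y i * m\<^sup>2)" if "i \<in> A" for i
    using assms(1)[OF that] \<open>m \<noteq> 0\<close> by (simp add: field_simps power2_eq_square)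
  then have "(\<Sum>i\<in>A. 1 / y i) = (\<Sum>i\<in>A. 2 / m - y i / m\<^sup>2 + (y i - m)\<^sup>2 / (y i * m\<^sup>2))"
    by (rule sum.cong[OF refl])
  also have "\<dots> = real (card A) * (2 / m) - (\<Sum>i\<in>A. y i) / m\<^sup>2
      + (\<Sum>i\<in>A. (y i - m)\<^sup>2 / (y i * m\<^sup>2))"
    by (simp add: sum.distrib sum_subtractf sum_divide_distrib)
  \<comment> \<open>As the \<open>y i\<close> sum to \<open>card A\<close> times \<open>m\<close>,
    the subtracted part is \<open>card A / m\<close>, half of the constant part.\<close>
  also have "real (card A) * (2 / m) - (\<Sum>i\<in>A. y i) / m\<^sup>2 = real (card A) / m"
    unfolding sum using \<open>m \<noteq> 0\<close> by (simp add: field_simps power2_eq_square)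
  finally show ?thesis .
qed

theorem theorem2p1:
  fixes n :: nat and x :: "nat \<Rightarrow> real" and S xbar :: real
  assumes "n \<ge> 1"
    and "\<And>i. i \<in> {1..n} \<Longrightarrow> S - x i > 0"
    and "xbar = (1 / real n) * (\<Sum>i=1..n. x i)"
  shows "(\<Sum>i=1..n. 1 / (S - x i)) \<ge> real n / (S - xbar) \<and>
    ((\<Sum>i=1..n. 1 / (S - x i)) = real n / (S - xbar) \<longleftrightarrow>
      (\<forall>i\<in>{1..n}. \<forall>j\<in>{1..n}. x i = x j))"
proof -
  define m where "m = S - xbar"
  define gap where "gap i = (S - x i - m)\<^sup>2 / ((S - x i) * m\<^sup>2)" for i
  have sum_x: "(\<Sum>i=1..n. x i) = real n * xbar"
    using assms(1,3) by simp
  then have mean: "(\<Sum>i=1..n. S - x i) = real n * m"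
    by (simp add: m_def sum_subtractf right_diff_distrib)
  \<comment> \<open>Since \<open>n \<ge> 1\<close>, the sum is nonempty and thus strictly positive;
    being \<open>n * m\<close>, it forces \<open>m > 0\<close>.\<close>
  have "(\<Sum>i=1..n. S - x i) > 0"
    using assms(1,2) by (intro sum_pos) auto
  then have "m > 0"
    unfolding mean by (simp add: zero_less_mult_iff)
  have sum_gap: "(\<Sum>i=1..n. 1 / (S - x i)) = real n / m + (\<Sum>i=1..n. gap i)"
    unfolding gap_def
  proof (subst sum_inverse_eq_mean_plus_gap)
    show "S - x i \<noteq> 0" if "i \<in> {1..n}" for i
      using assms(2)[OF that] by simp
  qed (use \<open>m > 0\<close> mean in simp_all)
  have gap_nonneg: "gap i \<ge> 0" if "i \<in> {1..n}" for i
    using assms(2)[OF that] by (simp add: gap_def)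
  \<comment> \<open>The denominator is positive, and the numerator is the square of
    \<open>xbar - x i\<close>.\<close>
  have gap_eq_0: "gap i = 0 \<longleftrightarrow> x i = xbar" if "i \<in> {1..n}" for i
    using assms(2)[OF that] \<open>m > 0\<close> by (auto simp: gap_def m_def)
  have "(\<Sum>i=1..n. gap i) = 0 \<longleftrightarrow> (\<forall>i\<in>{1..n}. gap i = 0)"
    by (intro sum_nonneg_eq_0_iff gap_nonneg finite_atLeastAtMost)
  also have "\<dots> \<longleftrightarrow> (\<forall>i\<in>{1..n}. x i = xbar)"
    by (intro ball_cong refl gap_eq_0)
  also have "\<dots> \<longleftrightarrow> (\<forall>i\<in>{1..n}. \<forall>j\<in>{1..n}. x i = x j)"
  proof
    assume const: "\<forall>i\<in>{1..n}. \<forall>j\<in>{1..n}. x i = x j"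
    show "\<forall>i\<in>{1..n}. x i = xbar"
    proof
      fix i assume i: "i \<in> {1..n}"
      \<comment> \<open>Both \<open>n * x i\<close> and \<open>n * xbar\<close> equal the sum of the
        \<open>x j\<close>, and \<open>n\<close> cancels.\<close>
      have "(\<Sum>j=1..n. x j) = (\<Sum>j=1..n. x i)"
        using const i by (intro sum.cong refl) blast
      with sum_x assms(1) show "x i = xbar"
        by simp
    qed
  next
    assume "\<forall>i\<in>{1..n}. x i = xbar"
    then show "\<forall>i\<in>{1..n}. \<forall>j\<in>{1..n}. x i = x j"
      by metis
  qed
  finally have "(\<Sum>i=1..n. gap i) = 0 \<longleftrightarrow> (\<forall>i\<in>{1..n}. \<forall>j\<in>{1..n}. x i = x j)" .
  moreover have "(\<Sum>i=1..n. gap i) \<ge> 0"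
    by (intro sum_nonneg gap_nonneg)
  \<comment> \<open>After rewriting, the two sides differ by exactly the sum of the gaps.\<close>
  ultimately show ?thesis
    unfolding sum_gap m_def[symmetric] by linarith
qed

end
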